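(* Let $\mu>-1/2$. (i) There are finite constants $a_e>0$, $b_e>0$ and $c_e\ge0$ such that for all $f_e\in\mathcal{B}^2_{e,\mu}$, $$a_e\,S_{L^2(\nu_{e,\mu})}(f_e)\le b_e\,E_{e,\mu}(f_e)+c_e\,\|f_e\|^2_{L^2(\nu_{e,\mu})}.$$ (ii) There are finite constants $a_o>0$, $b_o>0$ and $c_o\ge0$ such that for all $f_o\in\mathcal{B}^2_{o,\mu}$, $$a_o\,S_{L^2(\nu_{o,\mu})}(f_o)\le b_o\,E_{o,\mu}(f_o)+c_o\,\|f_o\|^2_{L^2(\nu_{o,\mu})}.$$
   Context: Fix $\mu>-1/2$. For $x>0$ and $\alpha\in\mathbf{R}$, $K_\alpha(x)=\int_0^\infty e^{-x\cosh u}\cosh(\alpha u)\,du$ is the Macdonald function. On $\mathbf{C}$ define the finite measures $d\nu_{e,\mu}(z)=\nu_{e,\mu}(z)\,dx\,dy$ and $d\nu_{o,\mu}(z)=\nu_{o,\mu}(z)\,dx\,dy$ with densities, for $z\neq0$, $$\nu_{e,\mu}(z)=\frac{2^{\frac12-\mu}}{\pi\Gamma(\mu+\frac12)}K_{\mu-\frac12}(|z|^2)|z|^{2\mu+1},\qquad \nu_{o,\mu}(z)=\frac{2^{\frac12-\mu}}{\pi\Gamma(\mu+\frac12)}K_{\mu+\frac12}(|z|^2)|z|^{2\mu+1}.$$ $\mathcal{B}^2_{e,\mu}$ is the space of even entire functions $\mathbf{C}\to\mathbf{C}$ in $L^2(\mathbf{C},\nu_{e,\mu})$; $\mathcal{B}^2_{o,\mu}$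 is the space of odd entire functions in $L^2(\mathbf{C},\nu_{o,\mu})$. Entropy: for a finite measure space $(\Omega,\nu)$ and $f\in L^2(\Omega,\nu)$, $S_{L^2(\Omega,\nu)}(f)=\int_\Omega|f|^2\log|f|^2\,d\nu-\|f\|^2_{L^2}\log\|f\|^2_{L^2}\in(-\infty,+\infty]$, with $0\log0=0$; here $\Omega=\mathbf{C}$. $\mu$-deformed energies: $E_{e,\mu}(g)=\int_{\mathbf{C}}|z|^2|g(z)|^2\,d\nu_{e,\mu}(z)$ for $g\in\mathcal{B}^2_{e,\mu}$ and $E_{o,\mu}(h)=\int_{\mathbf{C}}|z|^2|h(z)|^2\,d\nu_{o,\mu}(z)$ for $h\in\mathcal{B}^2_{o,\mu}$, with values in $[0,+\infty]$. *)

theory Defs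
  imports "HOL-Complex_Analysis.Complex_Analysis"
begin

definition macdonald_K :: "real \<Rightarrow> real \<Rightarrow> real" where
  "macdonald_K \<alpha> x = (LBINT u:{0..}. exp (- x * cosh u) * cosh (\<alpha> * u))"

text \<open>The densities are meant for \<open>z \<noteq> 0\<close>; the origin is a Lebesgue null set, so the value
  there is irrelevant.\<close>

definition nu_e_density :: "real \<Rightarrow> complex \<Rightarrow> real" where
  "nu_e_density \<mu> z = 2 powr (1/2 - \<mu>) / (pi * Gamma (\<mu> + 1/2)) *
     macdonald_K (\<mu> - 1/2) ((cmod z)\<^sup>2) * cmod z powr (2 * \<mu> + 1)"

definition nu_o_density :: "real \<Rightarrow> complex \<Rightarrow> real" where
  "nu_o_density \<mu> z = 2 powr (1/2 - \<mu>) / (pi * Gamma (\<mu> + 1/2)) *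
     macdonald_K (\<mu> + 1/2) ((cmod z)\<^sup>2) * cmod z powr (2 * \<mu> + 1)"

definition nu_e :: "real \<Rightarrow> complex measure" where
  "nu_e \<mu> = density lborel (\<lambda>z. ennreal (nu_e_density \<mu> z))"

definition nu_o :: "real \<Rightarrow> complex measure" where
  "nu_o \<mu> = density lborel (\<lambda>z. ennreal (nu_o_density \<mu> z))"

lemma macdonald_K_measurable [measurable]: "macdonald_K \<alpha> \<in> borel_measurable borel"
proof -
  have "(\<lambda>x. LINT u|lborel. indicator {0..} u *\<^sub>R (exp (- x * cosh u) * cosh (\<alpha> * u)))
      \<in> borel_measurable borel"
  proof (rule sigma_finite_measure.borel_measurable_lebesgue_integral)
    show "sigma_finite_measure (lborel :: real measure)"
      by (rule sigma_finite_lborel)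
    have [measurable]: "(cosh :: real \<Rightarrow> real) \<in> borel_measurable borel"
      by (intro borel_measurable_continuous_onI continuous_intros)
    show "(\<lambda>(x, u). indicator {0..} u *\<^sub>R (exp (- x * cosh u) * cosh (\<alpha> * u)))
        \<in> borel_measurable (borel \<Otimes>\<^sub>M lborel)"
      by measurable
  qed
  then show ?thesis
    by (simp add: macdonald_K_def[abs_def] set_lebesgue_integral_def)
qed

text \<open>Since \<^const>\<open>density\<close> is only meaningful for measurable densities:\<close>

lemma nu_density_measurable [measurable]:
  "nu_e_density \<mu> \<in> borel_measurable borel" "nu_o_density \<mu> \<in> borel_measurable borel"
  unfolding nu_e_density_def[abs_def] nu_o_density_def[abs_def] by measurable

definition L2 :: "'a measure \<Rightarrow> ('a \<Rightarrow> complex) set" where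
  "L2 M = {f \<in> borel_measurable M. integrable M (\<lambda>z. (cmod (f z))\<^sup>2)}"

definition L2_norm :: "'a measure \<Rightarrow> ('a \<Rightarrow> complex) \<Rightarrow> real" where
  "L2_norm M f = sqrt (LINT z|M. (cmod (f z))\<^sup>2)"

definition B2_e :: "real \<Rightarrow> (complex \<Rightarrow> complex) set" where
  "B2_e \<mu> = {f. f holomorphic_on UNIV \<and> (\<forall>z. f (- z) = f z) \<and> f \<in> L2 (nu_e \<mu>)}"

definition B2_o :: "real \<Rightarrow> (complex \<Rightarrow> complex) set" where
  "B2_o \<mu> = {f. f holomorphic_on UNIV \<and> (\<forall>z. f (- z) = - f z) \<and> f \<in> L2 (nu_o \<mu>)}"

text \<open>The integral of a real function with values in the extended reals, as the difference of
  the integrals of its positive and negative parts.  It is used only for \<open>t ln t\<close> with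
  \<open>t \<ge> 0\<close> over a finite measure, where the negative part is bounded by \<open>1 / e\<close>, so the
  second term is finite and no \<open>\<infinity> - \<infinity>\<close> occurs.\<close>

definition ext_integral :: "'a measure \<Rightarrow> ('a \<Rightarrow> real) \<Rightarrow> ereal" where
  "ext_integral M g =
     enn2ereal (\<integral>\<^sup>+ z. ennreal (g z) \<partial>M) - enn2ereal (\<integral>\<^sup>+ z. ennreal (- g z) \<partial>M)"

text \<open>The convention \<open>0 log 0 = 0\<close> holds automatically, by the factor in front of \<^const>\<open>ln\<close>.\<close>

definition L2_entropy :: "'a measure \<Rightarrow> ('a \<Rightarrow> complex) \<Rightarrow> ereal" where
  "L2_entropy M f =
     ext_integral M (\<lambda>z. (cmod (f z))\<^sup>2 * ln ((cmod (f z))\<^sup>2))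
     - ereal ((L2_norm M f)\<^sup>2 * ln ((L2_norm M f)\<^sup>2))"

definition energy_e :: "real \<Rightarrow> (complex \<Rightarrow> complex) \<Rightarrow> ennreal" where
  "energy_e \<mu> g = (\<integral>\<^sup>+ z. ennreal ((cmod z)\<^sup>2 * (cmod (g z))\<^sup>2) \<partial>nu_e \<mu>)"

definition energy_o :: "real \<Rightarrow> (complex \<Rightarrow> complex) \<Rightarrow> ennreal" where
  "energy_o \<mu> h = (\<integral>\<^sup>+ z. ennreal ((cmod z)\<^sup>2 * (cmod (h z))\<^sup>2) \<partial>nu_o \<mu>)"

end

theory Submission
  imports Defs
begin

text \<open>
  Point evaluation is bounded on the weighted space: averaging Cauchy's formula for \<open>f\<^sup>2\<close> over squares
  centred at \<open>z\<close> bounds \<open>\<bar>f z\<bar>\<^sup>2\<close> by the area integral of \<open>\<bar>f\<bar>\<^sup>2\<close> over an annulus around \<open>z\<close>.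
  As the density may vanish at the origin, the inner radius is taken to be \<open>\<bar>z\<bar> + 1\<close>, so that
  the annulus avoids the unit disc; there the density is at least \<open>c exp (- k \<bar>w\<bar>\<^sup>2)\<close>.
  Hence \<open>\<bar>f z\<bar>\<^sup>2 \<le> N exp (A + B \<bar>z\<bar>\<^sup>2)\<close> with \<open>N\<close> the squared norm, and multiplying the logarithm
  of this bound by \<open>\<bar>f\<bar>\<^sup>2\<close> and integrating gives the inequality.
\<close>

section \<open>Area and contour integrals in Cartesian coordinates\<close>

text \<open>The image of planar Lebesgue measure under \<open>(x, y) \<mapsto> Complex x y\<close>
  gives every box its usual area, so it is \<open>lborel\<close> on the complex numbers. Tonelli's
  theorem then splits the integral.\<close>

lemma nn_integral_lborel_complex:
  fixes H :: "complex \<Rightarrow> ennreal"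
  assumes [measurable]: "H \<in> borel_measurable borel"
  shows "(\<integral>\<^sup>+x. \<integral>\<^sup>+y. H (Complex x y) \<partial>lborel \<partial>lborel) = (\<integral>\<^sup>+w. H w \<partial>lborel)"
proof -
  have cont: "continuous_on UNIV (\<lambda>p::real \<times> real. Complex (fst p) (snd p))"
    by (auto simp: complex_eq_iff Complex_eq intro!: continuous_intros)
  then have meas [measurable]: "(\<lambda>p. Complex (fst p) (snd p)) \<in> borel_measurable (borel :: (real \<times> real) measure)"
    by (rule borel_measurable_continuous_onI)
  have "lborel = distr (lborel :: (real \<times> real) measure) borel (\<lambda>p. Complex (fst p) (snd p))"
    (is "_ = ?D")
  proof (rule lborel_eqI)
    fix l u :: complex
    assume le: "\<And>b. b \<in> Basis \<Longrightarrow> l \<bullet> b \<le> u \<bullet> b"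
    have vim: "(\<lambda>p. Complex (fst p) (snd p)) -` box l u = box (Re l, Im l) (Re u, Im u)"
      by (auto simp: in_box_complex_iff mem_box Basis_prod_def)
    have "emeasure ?D (box l u) = emeasure lborel (box (Re l, Im l) (Re u, Im u))"
      by (simp add: emeasure_distr vim)
    also have "\<dots> = ennreal (\<Prod>b\<in>Basis. (u - l) \<bullet> b)"
      using le[of 1] le[of \<i>]
      by (subst emeasure_lborel_box)
         (auto simp: Basis_prod_def Basis_complex_def prod.union_disjoint)
    finally show "emeasure ?D (box l u) = ennreal (\<Prod>b\<in>Basis. (u - l) \<bullet> b)" .
  qed simp
  then have "(\<integral>\<^sup>+w. H w \<partial>lborel) = (\<integral>\<^sup>+w. H w \<partial>?D)"
    by (rule arg_cong)
  also have "\<dots> = (\<integral>\<^sup>+p. H (Complex (fst p) (snd p)) \<partial>(lborel :: (real \<times> real) measure))"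
    by (rule nn_integral_distr) auto
  also have "\<dots> = (\<integral>\<^sup>+x. \<integral>\<^sup>+y. H (Complex x y) \<partial>lborel \<partial>lborel)"
    unfolding lborel_prod[symmetric]
    by (subst lborel.nn_integral_fst[symmetric]) (auto simp: lborel_prod)
  finally show ?thesis by simp
qed

text \<open>Multiplication by \<open>\<i>\<close> turns a horizontal segment into a vertical one,
  where \<open>contour_integral_linepath_same_Re\<close> applies. The factor \<open>\<i>\<close>
  appears on both sides and cancels.\<close>

lemma contour_integral_linepath_same_Im:
  assumes "Im z = c" "Im z' = c" "Re z = a" "Re z' = b" "a < b"
  shows "contour_integral (linepath z z') f = integral {a..b} (\<lambda>x. f (Complex x c))"
proof -
  have "contour_integral (linepath (\<i> * z) (\<i> * z')) (\<lambda>w. f (- \<i> * w)) =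
      \<i> * contour_integral (linepath z z') f"
  proof -
    have "- \<i> * linepath (\<i> * z) (\<i> * z') x = linepath z z' x" for x
      by (simp add: linepath_def scaleR_conv_of_real algebra_simps)
    moreover have "\<i> * z' - \<i> * z = \<i> * (z' - z)" by (simp add: algebra_simps)
    ultimately show ?thesis
      unfolding contour_integral_integral
      by (simp add: mult.assoc del: integral_mult_right flip: right_diff_distrib)
  qed
  moreover have "contour_integral (linepath (\<i> * z) (\<i> * z')) (\<lambda>w. f (- \<i> * w)) =
      \<i> * integral {a..b} (\<lambda>x. f (- \<i> * Complex (-c) x))"
    using assms by (intro contour_integral_linepath_same_Re) auto
  moreover have "- \<i> * Complex (-c) x = Complex x c" for x
    by (simp add: complex_eq_iff)
  ultimately show ?thesis by simp
qed

section \<open>Cauchy's formula on squares and its average over the side length\<close>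

text \<open>Every boundary point of the square with half-side \<open>s\<close> has modulus at least
  \<open>s\<close>, hence at least 1, so the Cauchy kernel \<open>1 / w\<close> may be bounded by 1.
  Squares serve better than circles here: averaging over \<open>s\<close> becomes an integral in
  Cartesian coordinates.\<close>

lemma Cauchy_square_bound:
  assumes holo: "g holomorphic_on UNIV" and s: "s \<ge> 1"
  shows "2 * pi * cmod (g 0) \<le> integral {-s..s} (\<lambda>v.
    cmod (g (Complex v (-s))) + cmod (g (Complex v s)) + cmod (g (Complex s v)) + cmod (g (Complex (-s) v)))"
proof -
  define a b where "a = Complex (-s) (-s)" and "b = Complex s s"
  define h where "h w = g w / w" for w
  have box0: "0 \<in> box a b" using s by (auto simp: in_box_complex_iff a_def b_def)
  have "((\<lambda>w. g w / (w - 0)) has_contour_integral (2*pi * \<i> * winding_number (rectpath a b) 0 * g 0)) (rectpath a b)"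
    by (rule Cauchy_integral_formula_convex_simple[OF convex_UNIV holo])
       (use box0 s in \<open>auto simp: path_image_rectpath_cbox_minus_box a_def b_def\<close>)
  then have C: "(h has_contour_integral (2*pi * \<i> * g 0)) (rectpath a b)"
    by (simp add: winding_number_rectpath[OF box0] h_def[abs_def])
  have contg: "continuous_on A g" for A
    using holo holomorphic_on_imp_continuous_on continuous_on_subset by blast
  have conth: "continuous_on A h" if "0 \<notin> A" for A
    unfolding h_def using that by (auto intro!: continuous_intros contg)
  have "0 \<notin> path_image (rectpath a b)"
    using box0 s by (auto simp: path_image_rectpath_cbox_minus_box a_def b_def)
  then have ch: "continuous_on (path_image (rectpath a b)) h"
    by (rule conth)
  let ?a2 = "Complex s (-s)" and ?a4 = "Complex (-s) s"
  have R: "rectpath a b = linepath a ?a2 +++ linepath ?a2 b +++ linepath b ?a4 +++ linepath ?a4 a"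
    by (simp add: rectpath_def a_def b_def Let_def)
  have int: "h contour_integrable_on linepath a ?a2" "h contour_integrable_on linepath ?a2 b"
       "h contour_integrable_on linepath b ?a4" "h contour_integrable_on linepath ?a4 a"
    using ch unfolding R
    by (auto simp: path_image_join intro!: contour_integrable_continuous_linepath elim: continuous_on_subset)
  have "2*pi * \<i> * g 0 = contour_integral (linepath a ?a2) h + contour_integral (linepath ?a2 b) h
      + contour_integral (linepath b ?a4) h + contour_integral (linepath ?a4 a) h"
    using contour_integral_unique[OF C] int unfolding R by (simp add: add.assoc)
  \<comment> \<open>The top and left sides are traversed towards decreasing coordinates, whereas the
    formulas for axis-parallel segments require increasing ones; both sides are therefore
    reversed.\<close>
  also have "contour_integral (linepath b ?a4) h = - contour_integral (linepath ?a4 b) h"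
    by (rule contour_integral_reverse_linepath[OF continuous_on_subset[OF ch]])
       (auto simp: R path_image_join)
  also have "contour_integral (linepath ?a4 a) h = - contour_integral (linepath a ?a4) h"
    by (rule contour_integral_reverse_linepath[OF continuous_on_subset[OF ch]])
       (auto simp: R path_image_join)
  finally have eq: "2*pi * \<i> * g 0 = integral {-s..s} (\<lambda>v. h (Complex v (-s)))
     + \<i> * integral {-s..s} (\<lambda>v. h (Complex s v)) - integral {-s..s} (\<lambda>v. h (Complex v s))
     - \<i> * integral {-s..s} (\<lambda>v. h (Complex (-s) v))"
    using s contour_integral_linepath_same_Im[of a "-s" ?a2 "-s" s h]
     contour_integral_linepath_same_Im[of ?a4 s b "-s" s h]
     contour_integral_linepath_same_Re[of ?a2 s b "-s" s h]
     contour_integral_linepath_same_Re[of a "-s" ?a4 "-s" s h]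
    by (simp add: a_def b_def)
  have cx: "continuous_on A (\<lambda>v. Complex v c)" "continuous_on A (\<lambda>v. Complex c v)" for A c
    by (auto simp: Complex_eq intro!: continuous_intros)
  \<comment> \<open>One estimate for all four sides: \<open>p\<close> parametrizes a side, and its
    distance at least \<open>s\<close> from the origin both excludes the pole of \<open>h\<close>
    and gives \<open>cmod (h (p v)) \<le> cmod (g (p v))\<close>.\<close>
  have hint: "norm (integral {-s..s} (\<lambda>v. h (p v))) \<le> integral {-s..s} (\<lambda>v. cmod (g (p v)))"
    if p: "continuous_on {-s..s} p" "\<And>v. cmod (p v) \<ge> s" for p
  proof (rule integral_norm_bound_integral)
    have "0 \<notin> p ` {-s..s}" using p(2) s by (metis imageE norm_zero not_one_le_zero order_trans)
    then show "(\<lambda>v. h (p v)) integrable_on {-s..s}"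
      by (intro integrable_continuous_interval continuous_on_compose2[OF conth p(1)]) auto
    show "(\<lambda>v. cmod (g (p v))) integrable_on {-s..s}"
      by (intro integrable_continuous_interval continuous_intros continuous_on_compose2[OF contg p(1)]) auto
    fix v show "cmod (h (p v)) \<le> cmod (g (p v))"
      using p(2)[of v] s mult_left_mono[of 1 "cmod (p v)" "cmod (g (p v))"]
      by (auto simp: h_def norm_divide divide_simps)
  qed
  have ge: "s \<le> cmod (Complex s v)" "s \<le> cmod (Complex (-s) v)"
    "s \<le> cmod (Complex v s)" "s \<le> cmod (Complex v (-s))" for v
    using abs_Re_le_cmod[of "Complex s v"] abs_Re_le_cmod[of "Complex (-s) v"]
      abs_Im_le_cmod[of "Complex v s"] abs_Im_le_cmod[of "Complex v (-s)"] by auto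
  have "2 * pi * cmod (g 0) = cmod (2*pi * \<i> * g 0)"
    by (simp add: norm_mult)
  also have "\<dots> \<le> cmod (integral {-s..s} (\<lambda>v. h (Complex v (-s))))
     + cmod (integral {-s..s} (\<lambda>v. h (Complex s v))) + cmod (integral {-s..s} (\<lambda>v. h (Complex v s)))
     + cmod (integral {-s..s} (\<lambda>v. h (Complex (-s) v)))"
    unfolding eq
    by (intro norm_triangle_le norm_triangle_le_diff add_mono) (auto simp: norm_mult)
  also have "\<dots> \<le> integral {-s..s} (\<lambda>v. cmod (g (Complex v (-s))))
     + integral {-s..s} (\<lambda>v. cmod (g (Complex s v))) + integral {-s..s} (\<lambda>v. cmod (g (Complex v s)))
     + integral {-s..s} (\<lambda>v. cmod (g (Complex (-s) v)))"
    by (intro add_mono hint cx ge)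
  also have "\<dots> = integral {-s..s} (\<lambda>v.
    cmod (g (Complex v (-s))) + cmod (g (Complex v s)) + cmod (g (Complex s v)) + cmod (g (Complex (-s) v)))"
  proof -
    have [simp]: "(\<lambda>v. cmod (g (Complex v c))) integrable_on {-s..s}"
        "(\<lambda>v. cmod (g (Complex c v))) integrable_on {-s..s}" for c
      by (rule integrable_continuous_interval continuous_on_norm subset_UNIV
          continuous_on_compose2[OF contg[of UNIV] cx(1)] continuous_on_compose2[OF contg[of UNIV] cx(2)])+
    show ?thesis by (simp add: integral_add integrable_add)
  qed
  finally show ?thesis .
qed

text \<open>The square bound is integrated over \<open>s\<close> from \<open>R\<close> to
  \<open>R + 1\<close>. As \<open>s\<close> varies, each of the four sides sweeps out part of the
  annulus \<open>A\<close>, without overlap, so each contributes at most the integral over all of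
  \<open>A\<close>; this is the factor 4.\<close>

lemma norm_le_annulus_integral:
  assumes holo: "g holomorphic_on UNIV" and R: "R \<ge> 1"
  defines "A \<equiv> {w. R \<le> cmod w \<and> cmod w \<le> 2 * (R + 1)}"
  shows "ennreal (2 * pi * cmod (g 0)) \<le> 4 * (\<integral>\<^sup>+w. ennreal (cmod (g w)) * indicator A w \<partial>lborel)"
proof -
  define H :: "complex \<Rightarrow> ennreal" where "H w = ennreal (cmod (g w)) * indicator A w" for w
  have contg: "continuous_on B g" for B
    using holo holomorphic_on_imp_continuous_on continuous_on_subset by blast
  have [measurable]: "g \<in> borel_measurable borel"
    by (rule borel_measurable_continuous_onI[OF contg])
  have [measurable]: "A \<in> sets borel" unfolding A_def by measurable
  have [measurable]: "H \<in> borel_measurable borel" unfolding H_def by measurable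
  have cx: "continuous_on B (\<lambda>p::real \<times> real. Complex (fst p) (snd p))" for B
    by (auto simp: Complex_eq intro!: continuous_intros)
  have [measurable]: "(\<lambda>p. Complex (fst p) (snd p)) \<in> borel_measurable (borel \<Otimes>\<^sub>M borel :: (real \<times> real) measure)"
    unfolding borel_prod by (rule borel_measurable_continuous_onI[OF cx])
  \<comment> \<open>This rule lets the \<open>measurable\<close> method handle all the slices of
    \<open>H\<close> along horizontal and vertical lines.\<close>
  have mC [measurable (raw)]: "(\<lambda>x. Complex (f x) (h x)) \<in> borel_measurable M"
    if [measurable]: "f \<in> borel_measurable M" "h \<in> borel_measurable M" for f h and M :: "'z measure"
    using measurable_compose[of "\<lambda>x. (f x, h x)" M "borel \<Otimes>\<^sub>M borel" "\<lambda>p. Complex (fst p) (snd p)" borel] by simp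
  define I where "I = (\<integral>\<^sup>+w. H w \<partial>lborel)"
  let ?F = "\<lambda>s v. H (Complex v (-s)) + H (Complex v s) + H (Complex s v) + H (Complex (-s) v)"
  have slice: "ennreal (2 * pi * cmod (g 0)) * indicator {R..R+1} s \<le> (\<integral>\<^sup>+v. ?F s v \<partial>lborel)" for s
  proof (cases "s \<in> {R..R+1}")
    case True
    then have s: "R \<le> s" "s \<le> R + 1" by auto
    let ?f = "\<lambda>v. cmod (g (Complex v (-s))) + cmod (g (Complex v s)) + cmod (g (Complex s v)) + cmod (g (Complex (-s) v))"
    have cy: "continuous_on B (\<lambda>v. Complex v c)" "continuous_on B (\<lambda>v. Complex c v)" for B c
      by (auto simp: Complex_eq intro!: continuous_intros)
    have cf: "continuous_on {-s..s} ?f"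
      by (intro continuous_intros continuous_on_compose2[OF contg cy(1)] continuous_on_compose2[OF contg cy(2)]) auto
    have "ennreal (2 * pi * cmod (g 0)) \<le> ennreal (integral {-s..s} ?f)"
      using Cauchy_square_bound[OF holo, of s] s R by (intro ennreal_leI) auto
    also have "\<dots> = (\<integral>\<^sup>+v. ennreal (?f v * indicator {-s..s} v) \<partial>lborel)"
    proof -
      have "(?f has_integral integral {-s..s} ?f) {-s..s}"
        using cf by (intro integrable_integral integrable_continuous_interval)
      then have "((\<lambda>v. ?f v * indicator {-s..s} v) has_integral integral {-s..s} ?f) UNIV"
        by (subst (asm) has_integral_restrict_UNIV[symmetric])
           (simp add: indicator_def if_distrib[of "(*) _"] of_bool_def cong: if_cong)
      then show ?thesis
        by (subst nn_integral_has_integral_lborel) auto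
    qed
    also have "\<dots> \<le> (\<integral>\<^sup>+v. ?F s v \<partial>lborel)"
    proof (rule nn_integral_mono)
      fix v
      \<comment> \<open>A boundary point of the square satisfies
        \<open>s \<le> cmod w \<le> 2 * s\<close>. With \<open>R \<le> s \<le> R + 1\<close> this
        yields exactly the two radii of \<open>A\<close>.\<close>
      have mem: "Complex x y \<in> A" if "\<bar>x\<bar> \<le> s" "\<bar>y\<bar> \<le> s" "\<bar>x\<bar> = s \<or> \<bar>y\<bar> = s" for x y
      proof -
        have "cmod (Complex x y) \<le> \<bar>x\<bar> + \<bar>y\<bar>" using cmod_le[of "Complex x y"] by simp
        moreover have "\<bar>x\<bar> \<le> cmod (Complex x y)" "\<bar>y\<bar> \<le> cmod (Complex x y)"
          using abs_Re_le_cmod[of "Complex x y"] abs_Im_le_cmod[of "Complex x y"] by auto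
        ultimately show ?thesis using that s unfolding A_def by auto
      qed
      show "ennreal (?f v * indicator {-s..s} v) \<le> ?F s v"
      proof (cases "v \<in> {-s..s}")
        case True
        then have "\<bar>v\<bar> \<le> s" "s \<ge> 0" by auto
        then show ?thesis using True by (simp add: H_def mem ennreal_plus)
      qed simp
    qed
    finally show ?thesis using True by simp
  qed simp
  \<comment> \<open>The interval of side parameters has length 1, so averaging introduces no further
    constant.\<close>
  have "ennreal (2 * pi * cmod (g 0)) = (\<integral>\<^sup>+s. ennreal (2 * pi * cmod (g 0)) * indicator {R..R+1} s \<partial>lborel)"
    by (simp add: nn_integral_cmult_indicator)
  also have "\<dots> \<le> (\<integral>\<^sup>+s. \<integral>\<^sup>+v. ?F s v \<partial>lborel \<partial>lborel)"
    by (intro nn_integral_mono slice)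
  \<comment> \<open>The reflection \<open>s \<mapsto> - s\<close> and an exchange of the order of
    integration carry each of the four iterated integrals to \<open>I\<close>.\<close>
  also have "\<dots> = (\<integral>\<^sup>+s. \<integral>\<^sup>+v. H (Complex v (-s)) \<partial>lborel \<partial>lborel) + (\<integral>\<^sup>+s. \<integral>\<^sup>+v. H (Complex v s) \<partial>lborel \<partial>lborel)
     + (\<integral>\<^sup>+s. \<integral>\<^sup>+v. H (Complex s v) \<partial>lborel \<partial>lborel) + (\<integral>\<^sup>+s. \<integral>\<^sup>+v. H (Complex (-s) v) \<partial>lborel \<partial>lborel)"
    by (simp add: nn_integral_add)
  also have "(\<integral>\<^sup>+s. \<integral>\<^sup>+v. H (Complex s v) \<partial>lborel \<partial>lborel) = I"
    unfolding I_def by (rule nn_integral_lborel_complex) measurable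
  also have "(\<integral>\<^sup>+s. \<integral>\<^sup>+v. H (Complex (-s) v) \<partial>lborel \<partial>lborel) = (\<integral>\<^sup>+s. \<integral>\<^sup>+v. H (Complex s v) \<partial>lborel \<partial>lborel)"
    using nn_integral_real_affine[of "\<lambda>s. \<integral>\<^sup>+v. H (Complex s v) \<partial>lborel" "-1" 0] by simp
  also have "\<dots> = I"
    unfolding I_def by (rule nn_integral_lborel_complex) measurable
  also have "(\<integral>\<^sup>+s. \<integral>\<^sup>+v. H (Complex v (-s)) \<partial>lborel \<partial>lborel) = (\<integral>\<^sup>+s. \<integral>\<^sup>+v. H (Complex v s) \<partial>lborel \<partial>lborel)"
    using nn_integral_real_affine[of "\<lambda>s. \<integral>\<^sup>+v. H (Complex v s) \<partial>lborel" "-1" 0] by simp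
  also have "(\<integral>\<^sup>+s. \<integral>\<^sup>+v. H (Complex v s) \<partial>lborel \<partial>lborel) = (\<integral>\<^sup>+s. \<integral>\<^sup>+v. H (Complex s v) \<partial>lborel \<partial>lborel)"
    by (rule lborel_pair.Fubini') measurable
  also have "\<dots> = I"
    unfolding I_def by (rule nn_integral_lborel_complex) measurable
  also have "I + I + I + I = 4 * I"
    by (metis (no_types, lifting) add.assoc mult_2 numeral_Bit0 distrib_right)
  finally show ?thesis by (simp add: I_def H_def)
qed

section \<open>Lower bound for the Macdonald function\<close>

text \<open>The Bochner integral of a non-integrable function is 0 by default, so integrability must
  be secured before \<open>macdonald_K\<close> can be bounded below by shrinking the domain. The
  quadratic growth of \<open>cosh u\<close> beats the linear exponent of
  \<open>cosh (\<alpha> * u)\<close>, leaving the majorant \<open>C * exp (- u)\<close>.\<close>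

lemma macdonald_K_integrable:
  fixes x \<alpha> :: real
  assumes "x \<ge> 1"
  shows "set_integrable lborel {0..} (\<lambda>u. exp (- x * cosh u) * cosh (\<alpha> * u))"
proof -
  define C where "C = exp ((\<bar>\<alpha>\<bar> + 1)\<^sup>2)"
  have cosh_meas [measurable]: "(cosh :: real \<Rightarrow> real) \<in> borel_measurable borel"
    by (intro borel_measurable_continuous_onI continuous_intros)
  have "set_integrable lebesgue {0::real..} (\<lambda>u. exp (- 1 * u))"
    by (rule nonnegative_absolutely_integrable_1[OF integrable_on_exp_minus_to_infinity]) auto
  then have "set_integrable lborel {0::real..} (\<lambda>u. exp (- u))"
    unfolding set_integrable_def by (subst (asm) integrable_completion) auto
  then have "set_integrable lborel {0::real..} (\<lambda>u. C * exp (- u))"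
    by (rule set_integrable_mult_right)
  then show ?thesis
    unfolding set_integrable_def
  proof (rule Bochner_Integration.integrable_bound)
    show "AE u in lborel. norm (indicat_real {0..} u *\<^sub>R (exp (- x * cosh u) * cosh (\<alpha> * u)))
        \<le> norm (indicat_real {0..} u *\<^sub>R (C * exp (- u)))"
    proof (intro AE_I2)
      fix u :: real
      show "norm (indicat_real {0..} u *\<^sub>R (exp (- x * cosh u) * cosh (\<alpha> * u)))
        \<le> norm (indicat_real {0..} u *\<^sub>R (C * exp (- u)))"
      proof (cases "u \<ge> 0")
        case True
        have "u\<^sup>2 / 4 \<le> exp u / 2" using exp_lower_Taylor_quadratic[OF True] True by simp
        also have "\<dots> \<le> cosh u" by (simp add: cosh_field_def)
        also have "cosh u \<le> x * cosh u" using assms mult_right_mono[of 1 x "cosh u"] by simp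
        finally have 1: "u\<^sup>2 / 4 \<le> x * cosh u" .
        have "exp (\<alpha> * u) \<le> exp (\<bar>\<alpha>\<bar> * u)" "exp (- (\<alpha> * u)) \<le> exp (\<bar>\<alpha>\<bar> * u)"
          using True mult_right_mono[of \<alpha> "\<bar>\<alpha>\<bar>" u] mult_right_mono[of "- \<alpha>" "\<bar>\<alpha>\<bar>" u]
          by simp_all
        then have 2: "cosh (\<alpha> * u) \<le> exp (\<bar>\<alpha>\<bar> * u)" 
          using add_mono[of "exp (\<alpha> * u)" "exp (\<bar>\<alpha>\<bar> * u)" "exp (- (\<alpha> * u))" "exp (\<bar>\<alpha>\<bar> * u)"]
          by (simp add: cosh_field_def)
        \<comment> \<open>Completing the square bounds
          \<open>\<bar>\<alpha>\<bar> * u + u - u * u / 4\<close> by the exponent in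
          \<open>C\<close>; the summand 1 beside \<open>\<bar>\<alpha>\<bar>\<close> produces the
          decay \<open>exp (- u)\<close>.\<close>
        have "0 \<le> (u / 2 - (\<bar>\<alpha>\<bar> + 1))\<^sup>2" by simp
        then have 3: "- (x * cosh u) + \<bar>\<alpha>\<bar> * u \<le> (\<bar>\<alpha>\<bar> + 1)\<^sup>2 - u"
          using 1 by (simp add: power2_diff power_divide algebra_simps)
        have "exp (- x * cosh u) * cosh (\<alpha> * u) \<le> exp (- x * cosh u) * exp (\<bar>\<alpha>\<bar> * u)"
          using 2 by simp
        also have "\<dots> \<le> C * exp (- u)"
          using 3 by (simp add: C_def flip: exp_add)
        finally show ?thesis using True by (simp add: C_def abs_mult)
      qed simp
    qed
  qed measurable
qed

text \<open>The integrand is nonnegative, so only \<open>{0..1}\<close> is kept; there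
  \<open>cosh u \<le> cosh 1\<close> and \<open>cosh (\<alpha> * u) \<ge> 1\<close>. The bound does
  not depend on \<open>\<alpha>\<close> and thus serves both measures.\<close>

lemma macdonald_K_ge:
  assumes "x \<ge> 1"
  shows "macdonald_K \<alpha> x \<ge> exp (- x * cosh 1)"
proof -
  have "exp (- x * cosh 1) = (LBINT u:{0..1::real}. exp (- x * cosh (1::real)))"
    by (simp add: set_lebesgue_integral_def)
  also have "\<dots> \<le> macdonald_K \<alpha> x"
    unfolding macdonald_K_def set_lebesgue_integral_def
  proof (rule integral_mono)
    show "integrable lborel (\<lambda>u. indicat_real {0..} u *\<^sub>R (exp (- x * cosh u) * cosh (\<alpha> * u)))"
      using macdonald_K_integrable[OF assms] unfolding set_integrable_def .
    fix u :: real
    show "indicat_real {0..1} u *\<^sub>R exp (- x * cosh 1)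
         \<le> indicat_real {0..} u *\<^sub>R (exp (- x * cosh u) * cosh (\<alpha> * u))"
    proof (cases "u \<in> {0..1}")
      case True
      then have "cosh u \<le> cosh 1" by (subst cosh_real_nonneg_le_iff) auto
      then have "exp (- x * cosh 1) * 1 \<le> exp (- x * cosh u) * cosh (\<alpha> * u)"
        using assms by (intro mult_mono) (auto simp: cosh_real_ge_1)
      then show ?thesis using True by simp
    qed (auto simp: indicator_def)
  qed simp
  finally show ?thesis .
qed

section \<open>From a pointwise bound to an entropy inequality\<close>

text \<open>The logarithm of \<open>bound\<close>, multiplied by \<open>u\<close>, gives
  \<open>u ln u \<le> (ln N + A) u + B w u\<close>. After integration the term with
  \<open>ln N\<close> is exactly the \<open>N ln N\<close> subtracted in the entropy. The rest of
  the argument treats infinite integrals. In the application \<open>u\<close> is the squared modulus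
  of \<open>f\<close> and \<open>w\<close> that of \<open>z\<close>.\<close>

lemma entropy_le_weighted_integral:
  fixes u w :: "'a \<Rightarrow> real"
  assumes u: "integrable M u" "\<And>z. u z \<ge> 0" and w: "w \<in> borel_measurable M" "\<And>z. w z \<ge> 0"
    and B: "B > 0" and N: "N = (LINT z|M. u z)"
    and bound: "\<And>z. u z \<le> N * exp (A + B * w z)"
  shows "ext_integral M (\<lambda>z. u z * ln (u z)) - ereal (N * ln N)
     \<le> ereal B * enn2ereal (\<integral>\<^sup>+z. ennreal (w z * u z) \<partial>M) + ereal (A * N)"
proof -
  define g where "g z = u z * ln (u z)" for z
  have [measurable]: "u \<in> borel_measurable M" "w \<in> borel_measurable M" using u w by auto
  have [measurable]: "g \<in> borel_measurable M" unfolding g_def by measurable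
  have N0: "N \<ge> 0" unfolding N using u(2) by (rule Bochner_Integration.integral_nonneg)
  define h where "h z = (ln N + A) * u z + B * (w z * u z)" for z
  have gh: "g z \<le> h z" for z
  proof (cases "u z = 0")
    case False
    then have pos: "u z > 0" using u(2)[of z] by simp
    \<comment> \<open>A positive value of \<open>u\<close> rules out \<open>N = 0\<close> through
      \<open>bound\<close>, so \<open>ln N\<close> may be split off. Where \<open>u\<close>
      vanishes, both sides are 0.\<close>
    then have "N > 0" using bound[of z] N0 by (cases "N = 0") auto
    have "ln (u z) \<le> ln (N * exp (A + B * w z))" using bound[of z] pos by simp
    also have "\<dots> = ln N + A + B * w z" using \<open>N > 0\<close> by (simp add: ln_mult)
    finally have "u z * ln (u z) \<le> u z * (ln N + A + B * w z)" using pos by simp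
    then show ?thesis by (simp add: g_def h_def algebra_simps)
  qed (simp add: g_def h_def)
  show ?thesis
  proof (cases "(\<integral>\<^sup>+z. ennreal (w z * u z) \<partial>M) = \<infinity>")
    case True
    then show ?thesis using B by simp
  next
    case False
    have iwu: "integrable M (\<lambda>z. w z * u z)"
      using False u w by (intro integrableI_nonneg) (auto simp: top.not_eq_extremum)
    then have ih: "integrable M h" unfolding h_def using u by auto
    define P where "P = (\<integral>\<^sup>+ z. ennreal (g z) \<partial>M)"
    define Q where "Q = (\<integral>\<^sup>+ z. ennreal (- g z) \<partial>M)"
    have "P \<le> (\<integral>\<^sup>+ z. ennreal (norm (h z)) \<partial>M)"
      unfolding P_def by (intro nn_integral_mono ennreal_leI) (use gh in \<open>auto intro: order_trans[OF _ abs_ge_self]\<close>)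
    also have "\<dots> < \<infinity>" using ih by (simp add: integrable_iff_bounded)
    finally have P: "P < \<infinity>" .
    have E: "ext_integral M (\<lambda>z. u z * ln (u z)) = enn2ereal P - enn2ereal Q"
      unfolding ext_integral_def P_def Q_def g_def ..
    show ?thesis
    \<comment> \<open>The measure is arbitrary here, so the negative part may have infinite
      integral. Since \<open>P\<close> is finite, the left side is then
      \<open>- \<infinity>\<close>.\<close>
    proof (cases "Q = \<infinity>")
      case True
      have "enn2ereal P - enn2ereal Q = - \<infinity>"
        using P True by (cases P) (simp_all add: enn2ereal_ennreal)
      then show ?thesis unfolding E by simp
    next
      case False
      have ig: "integrable M g"
        unfolding real_integrable_def using P False by (auto simp: P_def Q_def)
      have "enn2ereal P - enn2ereal Q = ereal (enn2real P - enn2real Q)"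
        using P False by (cases P; cases Q) (simp_all add: enn2ereal_ennreal)
      also have "enn2real P - enn2real Q = (LINT z|M. g z)"
        unfolding P_def Q_def using real_lebesgue_integral_def[OF ig] by simp
      also have "\<dots> \<le> (LINT z|M. h z)" using ig ih gh by (rule integral_mono)
      also have "(LINT z|M. h z) = (ln N + A) * N + B * (LINT z|M. w z * u z)"
        unfolding h_def N using u iwu by simp
      finally have 1: "enn2ereal P - enn2ereal Q \<le> ereal ((ln N + A) * N + B * (LINT z|M. w z * u z))"
        by simp
      have 2: "(\<integral>\<^sup>+z. ennreal (w z * u z) \<partial>M) = ennreal (LINT z|M. w z * u z)"
        using iwu u w by (intro nn_integral_eq_integral) auto
      have "0 \<le> (LINT z|M. w z * u z)" using u w by (intro Bochner_Integration.integral_nonneg) auto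
      then have 3: "ereal B * enn2ereal (\<integral>\<^sup>+z. ennreal (w z * u z) \<partial>M) + ereal (A * N)
        = ereal (B * (LINT z|M. w z * u z) + A * N)" unfolding 2 by (simp add: enn2ereal_ennreal)
      have "enn2ereal P - enn2ereal Q - ereal (N * ln N)
          \<le> ereal ((ln N + A) * N + B * (LINT z|M. w z * u z)) - ereal (N * ln N)"
        using 1 by (rule ereal_minus_mono) simp
      then show ?thesis unfolding E 3 by (simp add: algebra_simps)
    qed
  qed
qed

section \<open>Pointwise growth of entire functions in the weighted space\<close>

lemma nn_integral_lborel_translate:
  fixes F :: "'a::euclidean_space \<Rightarrow> ennreal"
  assumes [measurable]: "F \<in> borel_measurable borel"
  shows "(\<integral>\<^sup>+w. F (z + w) \<partial>lborel) = (\<integral>\<^sup>+w. F w \<partial>lborel)"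
proof -
  have "(\<integral>\<^sup>+w. F w \<partial>lborel) = (\<integral>\<^sup>+w. F w \<partial>distr lborel borel ((+) z))"
    by (simp only: lborel_distr_plus)
  also have "\<dots> = (\<integral>\<^sup>+w. F (z + w) \<partial>lborel)"
    by (rule nn_integral_distr) auto
  finally show ?thesis by simp
qed

text \<open>The annulus estimate is applied to the square of \<open>w \<mapsto> f (z + w)\<close>,
  so that the squared modulus appears directly and no Cauchy-Schwarz step is required. On the
  translated annulus the weight \<open>D\<close> is at least \<open>1 / E\<close>, which turns the
  area integral into \<open>E * N\<close>.\<close>

lemma entire_square_le:
  fixes D :: "complex \<Rightarrow> real"
  assumes holo: "f holomorphic_on UNIV"
    and D [measurable]: "D \<in> borel_measurable borel"
    and c: "c > 0" and k: "k \<ge> 0"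
    and lower: "\<And>z. cmod z \<ge> 1 \<Longrightarrow> D z \<ge> c * exp (- k * (cmod z)\<^sup>2)"
    and int: "integrable (density lborel D) (\<lambda>z. (cmod (f z))\<^sup>2)"
  shows "(cmod (f z))\<^sup>2 \<le> (LINT z|density lborel D. (cmod (f z))\<^sup>2) * exp ((32 * k - ln c) + 18 * k * (cmod z)\<^sup>2)"
proof -
  define N where "N = (LINT z|density lborel D. (cmod (f z))\<^sup>2)"
  define E where "E = exp (k * (18 * (cmod z)\<^sup>2 + 32)) / c"
  define A where "A = {w. cmod z + 1 \<le> cmod w \<and> cmod w \<le> 2 * ((cmod z + 1) + 1)}"
  have E0: "E \<ge> 0" using c by (simp add: E_def)
  have N0: "N \<ge> 0" unfolding N_def by (rule Bochner_Integration.integral_nonneg) simp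
  have [measurable]: "f \<in> borel_measurable borel"
    by (rule borel_measurable_continuous_onI[OF holomorphic_on_imp_continuous_on[OF holo]])
  have NI: "(\<integral>\<^sup>+v. ennreal (D v) * ennreal ((cmod (f v))\<^sup>2) \<partial>lborel) = ennreal N"
    unfolding N_def using int
    by (subst nn_integral_eq_integral[symmetric]) (auto simp: nn_integral_density)
  have "(\<lambda>w. (f (z + w))\<^sup>2) holomorphic_on UNIV"
    by (intro holomorphic_intros holomorphic_on_compose_gen[OF _ holo, unfolded o_def]) auto
  from norm_le_annulus_integral[OF this, of "cmod z + 1"]
  have "ennreal (2 * pi * (cmod (f z))\<^sup>2)
      \<le> 4 * (\<integral>\<^sup>+w. ennreal ((cmod (f (z + w)))\<^sup>2) * indicator A w \<partial>lborel)"
    by (simp add: A_def norm_power)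
  also have "\<dots> \<le> 4 * (\<integral>\<^sup>+w. ennreal E * (ennreal (D (z + w)) * ennreal ((cmod (f (z + w)))\<^sup>2)) \<partial>lborel)"
  proof (intro mult_left_mono nn_integral_mono)
    fix w
    show "ennreal ((cmod (f (z + w)))\<^sup>2) * indicator A w
        \<le> ennreal E * (ennreal (D (z + w)) * ennreal ((cmod (f (z + w)))\<^sup>2))"
    proof (cases "w \<in> A")
      case True
      \<comment> \<open>The outer radius \<open>2 * cmod z + 4\<close> gives this upper bound, which
        makes the loss in the weight Gaussian in \<open>z\<close>. The inner radius
        \<open>cmod z + 1\<close> keeps \<open>z + w\<close> outside the open unit disc, where
        \<open>lower\<close> applies.\<close>
      then have le: "cmod (z + w) \<le> 3 * cmod z + 4"
        using norm_triangle_ineq[of z w] by (simp add: A_def)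
      have ge: "cmod (z + w) \<ge> 1"
        using True norm_triangle_ineq2[of w "- z"] by (simp add: A_def add.commute)
      have "(cmod (z + w))\<^sup>2 \<le> (3 * cmod z + 4)\<^sup>2" using le by (intro power_mono) auto
      \<comment> \<open>The square of a sum is at most twice the sum of the squares; this is the
        source of 18 and 32.\<close>
      also have "\<dots> \<le> 18 * (cmod z)\<^sup>2 + 32"
        using zero_le_power2[of "3 * cmod z - 4"] by (simp add: power2_eq_square algebra_simps)
      finally have "k * (cmod (z + w))\<^sup>2 \<le> k * (18 * (cmod z)\<^sup>2 + 32)"
        using k by (rule mult_left_mono)
      then have "1 \<le> exp (k * (18 * (cmod z)\<^sup>2 + 32)) * exp (- k * (cmod (z + w))\<^sup>2)"
        by (simp flip: exp_add)
      also have "\<dots> = E * (c * exp (- k * (cmod (z + w))\<^sup>2))"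
        using c by (simp add: E_def)
      also have "\<dots> \<le> E * D (z + w)" using lower[OF ge] E0 by (rule mult_left_mono)
      finally have ED: "1 \<le> E * D (z + w)" .
      \<comment> \<open>The sign matters because \<open>ennreal\<close> truncates negative values to
        0, so products could not be merged otherwise.\<close>
      then have D0: "D (z + w) \<ge> 0"
        using E0 by (smt (verit) mult_nonneg_nonpos)
      have "1 * (cmod (f (z + w)))\<^sup>2 \<le> (E * D (z + w)) * (cmod (f (z + w)))\<^sup>2"
        using ED by (rule mult_right_mono) simp
      then show ?thesis using True E0 D0
        by (simp add: ennreal_mult[symmetric] mult.assoc)
    qed simp
  qed simp
  also have "\<dots> = 4 * (ennreal E * (\<integral>\<^sup>+w. ennreal (D (z + w)) * ennreal ((cmod (f (z + w)))\<^sup>2) \<partial>lborel))"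
    by (subst nn_integral_cmult) auto
  also have "(\<integral>\<^sup>+w. ennreal (D (z + w)) * ennreal ((cmod (f (z + w)))\<^sup>2) \<partial>lborel) = ennreal N"
    unfolding NI[symmetric]
    by (rule nn_integral_lborel_translate[of "\<lambda>v. ennreal (D v) * ennreal ((cmod (f v))\<^sup>2)"]) measurable
  also have "4 * (ennreal E * ennreal N) = ennreal (4 * (E * N))"
    using E0 N0 by (simp add: ennreal_mult)
  finally have "2 * pi * (cmod (f z))\<^sup>2 \<le> 4 * (E * N)"
    using E0 N0 by (subst (asm) ennreal_le_iff) auto
  \<comment> \<open>The factor 4 from the four sides is absorbed by \<open>2 * pi\<close>.\<close>
  moreover have "4 * (cmod (f z))\<^sup>2 \<le> 2 * pi * (cmod (f z))\<^sup>2"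
    using pi_ge_two by (intro mult_right_mono) auto
  ultimately have "(cmod (f z))\<^sup>2 \<le> N * E" by (simp add: mult.commute)
  also have "E = exp ((32 * k - ln c) + 18 * k * (cmod z)\<^sup>2)"
    using c by (simp add: E_def exp_diff exp_add algebra_simps)
  finally show ?thesis unfolding N_def .
qed

text \<open>The growth bound supplies the hypothesis of \<open>entropy_le_weighted_integral\<close>
  with \<open>B = 18 * k\<close>. The constant \<open>32 * k - ln c\<close> may be negative; its
  absolute value gives a weaker bound with a nonnegative coefficient of the squared norm.\<close>

lemma entropy_le_energy:
  fixes D :: "complex \<Rightarrow> real"
  defines "M \<equiv> density lborel D"
  assumes D: "D \<in> borel_measurable borel"
    and c: "c > 0" and k: "k > 0"
    and lower: "\<And>z. cmod z \<ge> 1 \<Longrightarrow> D z \<ge> c * exp (- k * (cmod z)\<^sup>2)"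
    and f: "f holomorphic_on UNIV" "f \<in> L2 M"
  shows "L2_entropy M f \<le> ereal (18 * k) * enn2ereal (\<integral>\<^sup>+z. ennreal ((cmod z)\<^sup>2 * (cmod (f z))\<^sup>2) \<partial>M)
      + ereal (\<bar>32 * k - ln c\<bar> * (L2_norm M f)\<^sup>2)"
proof -
  define N where "N = (LINT z|M. (cmod (f z))\<^sup>2)"
  have int: "integrable M (\<lambda>z. (cmod (f z))\<^sup>2)" using f(2) by (simp add: L2_def)
  have N0: "N \<ge> 0" unfolding N_def by (rule Bochner_Integration.integral_nonneg) simp
  have norm: "(L2_norm M f)\<^sup>2 = N" using N0 by (simp add: L2_norm_def N_def)
  have "(cmod (f z))\<^sup>2 \<le> N * exp (\<bar>32 * k - ln c\<bar> + 18 * k * (cmod z)\<^sup>2)" for z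
  proof -
    have "(cmod (f z))\<^sup>2 \<le> N * exp ((32 * k - ln c) + 18 * k * (cmod z)\<^sup>2)"
      using entire_square_le[OF f(1) D c _ lower int[unfolded M_def]] k by (simp add: N_def M_def)
    also have "\<dots> \<le> N * exp (\<bar>32 * k - ln c\<bar> + 18 * k * (cmod z)\<^sup>2)"
      using N0 by (intro mult_left_mono) auto
    finally show ?thesis .
  qed
  then show ?thesis
    unfolding L2_entropy_def norm
    by (intro entropy_le_weighted_integral int N_def) (use k in \<open>auto simp: M_def\<close>)
qed

section \<open>Lower bound for both densities, and the conclusion\<close>

text \<open>The order \<open>\<alpha>\<close> is left free because the even and odd densities differ
  only there. Outside the open unit disc the power of \<open>cmod z\<close> is at least 1, its
  exponent being positive, and the Gamma factor is positive.\<close>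

lemma density_lower_bound:
  fixes \<mu> \<alpha> :: real
  assumes "\<mu> > - 1/2" "cmod z \<ge> 1"
  shows "2 powr (1/2 - \<mu>) / (pi * Gamma (\<mu> + 1/2)) * exp (- cosh 1 * (cmod z)\<^sup>2)
    \<le> 2 powr (1/2 - \<mu>) / (pi * Gamma (\<mu> + 1/2)) * macdonald_K \<alpha> ((cmod z)\<^sup>2) * cmod z powr (2 * \<mu> + 1)"
proof -
  have "exp (- cosh 1 * (cmod z)\<^sup>2) * 1 \<le> macdonald_K \<alpha> ((cmod z)\<^sup>2) * cmod z powr (2 * \<mu> + 1)"
  proof (rule mult_mono)
    show K: "exp (- cosh 1 * (cmod z)\<^sup>2) \<le> macdonald_K \<alpha> ((cmod z)\<^sup>2)"
      using macdonald_K_ge[of "(cmod z)\<^sup>2" \<alpha>] assms(2) by (simp add: mult.commute)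
    show "0 \<le> macdonald_K \<alpha> ((cmod z)\<^sup>2)" using K by (rule order_trans[rotated]) simp
    show "1 \<le> cmod z powr (2 * \<mu> + 1)" using assms by (intro ge_one_powr_ge_zero) auto
  qed simp
  moreover have "Gamma (\<mu> + 1/2) > 0" using assms by (intro Gamma_real_pos) auto
  then have "0 \<le> 2 powr (1/2 - \<mu>) / (pi * Gamma (\<mu> + 1/2))" by simp
  ultimately show ?thesis
    unfolding mult.assoc[of _ "macdonald_K _ _"] by (intro mult_left_mono) simp_all
qed

theorem theorem4p6:
  fixes \<mu> :: real
  assumes "\<mu> > - 1/2"
  shows "(\<exists>a b c :: real. a > 0 \<and> b > 0 \<and> c \<ge> 0 \<and>
            (\<forall>f \<in> B2_e \<mu>. ereal a * L2_entropy (nu_e \<mu>) f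
               \<le> ereal b * enn2ereal (energy_e \<mu> f) + ereal (c * (L2_norm (nu_e \<mu>) f)\<^sup>2)))
       \<and> (\<exists>a b c :: real. a > 0 \<and> b > 0 \<and> c \<ge> 0 \<and>
            (\<forall>f \<in> B2_o \<mu>. ereal a * L2_entropy (nu_o \<mu>) f
               \<le> ereal b * enn2ereal (energy_o \<mu> f) + ereal (c * (L2_norm (nu_o \<mu>) f)\<^sup>2)))"
proof -
  define c where "c = 2 powr (1/2 - \<mu>) / (pi * Gamma (\<mu> + 1/2))"
  have "Gamma (\<mu> + 1/2) > 0" using assms by (intro Gamma_real_pos) auto
  then have c: "c > 0" unfolding c_def by simp
  \<comment> \<open>These are the constants of \<open>entropy_le_energy\<close> for
    \<open>k = cosh 1\<close>, the rate in \<open>macdonald_K_ge\<close>. The same pair works for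
    the even and the odd measure, with \<open>a = 1\<close>.\<close>
  define b A :: real where "b = 18 * cosh 1" and "A = \<bar>32 * cosh 1 - ln c\<bar>"
  have bA: "b > 0" "A \<ge> 0" by (auto simp: b_def A_def)
  have cosh1: "cosh 1 > (0::real)" by simp
  have "ereal 1 * L2_entropy (nu_e \<mu>) f
      \<le> ereal b * enn2ereal (energy_e \<mu> f) + ereal (A * (L2_norm (nu_e \<mu>) f)\<^sup>2)" if f: "f \<in> B2_e \<mu>" for f
  proof -
    have "nu_e_density \<mu> z \<ge> c * exp (- cosh 1 * (cmod z)\<^sup>2)" if "cmod z \<ge> 1" for z
      unfolding nu_e_density_def c_def using density_lower_bound[OF assms that] .
    moreover have "f holomorphic_on UNIV" "f \<in> L2 (density lborel (nu_e_density \<mu>))"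
      using f by (simp_all add: B2_e_def nu_e_def)
    ultimately show ?thesis
      using entropy_le_energy[OF nu_density_measurable(1) c cosh1]
      unfolding nu_e_def energy_e_def b_def A_def one_ereal_def[symmetric] mult_1_left by blast
  qed
  moreover have "ereal 1 * L2_entropy (nu_o \<mu>) f
      \<le> ereal b * enn2ereal (energy_o \<mu> f) + ereal (A * (L2_norm (nu_o \<mu>) f)\<^sup>2)" if f: "f \<in> B2_o \<mu>" for f
  proof -
    have "nu_o_density \<mu> z \<ge> c * exp (- cosh 1 * (cmod z)\<^sup>2)" if "cmod z \<ge> 1" for z
      unfolding nu_o_density_def c_def using density_lower_bound[OF assms that] .
    moreover have "f holomorphic_on UNIV" "f \<in> L2 (density lborel (nu_o_density \<mu>))"
      using f by (simp_all add: B2_o_def nu_o_def)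
    ultimately show ?thesis
      using entropy_le_energy[OF nu_density_measurable(2) c cosh1]
      unfolding nu_o_def energy_o_def b_def A_def one_ereal_def[symmetric] mult_1_left by blast
  qed
  ultimately show ?thesis using bA zero_less_one by meson
qed

end
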